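(* Let $m\ge1$ be an integer. For all $(x,y)$ in $D=\{(x,y)\in\mathbb R^2:\sinh^2\frac{y}{m\sqrt2}>1\}$, $$\begin{aligned}&\tfrac12\left[\cosh^2\!\left(\tfrac{f_{\mathrm{ScherkTower}}(x,y)}{\sqrt2}\right)+\cosh^2\!\left(\tfrac{f_{\mathrm{ScherkTower}}(0,y)}{\sqrt2}\right)\right]\\&\quad=m^2\cdot\prod_{j=1}^{m-1}\frac1{\sin^2(\pi j/m)}\cdot\prod_{j=0}^{m-1}\left[\tfrac12\left(\cosh^2\!\left(\tfrac{1}{\sqrt2}f_{\mathrm{ScherkTower}}\big(\tfrac{x+2j\pi}m,\tfrac ym\big)\right)+\cosh^2\!\left(\tfrac{1}{\sqrt2}f_{\mathrm{ScherkTower}}\big(0,\tfrac ym\big)\right)\right)\right],\end{aligned}$$ and all the functions occurring are defined at the indicated points.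
   Context: Scherk's tower is the graph of $$f_{\mathrm{ScherkTower}}(x,y)=\sqrt2\,\cosh^{-1}\Big[\sqrt{\sinh^2\!\left(\tfrac y{\sqrt2}\right)+2\sin^2\!\left(\tfrac x2\right)}\Big],$$ where $\cosh^{-1}:[1,\infty)\to[0,\infty)$ and the function is defined where the argument of $\cosh^{-1}$ is at least $1$. The dilated and translated Scherk towers are $f^j_{\mathrm{Dil.ScherkTower}}(x,y)=f_{\mathrm{ScherkTower}}(\frac{x+2j\pi}m,\frac ym)$. *)

theory Defs
  imports Complex_Main
begin

definition scherk_tower_arg :: "real \<Rightarrow> real \<Rightarrow> real" where
  "scherk_tower_arg x y = sqrt ((sinh (y / sqrt 2))\<^sup>2 + 2 * (sin (x / 2))\<^sup>2)"

definition scherk_tower_dom :: "(real \<times> real) set" where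
  "scherk_tower_dom = {(x, y). scherk_tower_arg x y \<ge> 1}"

text \<open>
  Meaningful only on \<^const>\<open>scherk_tower_dom\<close>: on \<open>[1, \<infinity>)\<close> the constant
  \<^const>\<open>arcosh\<close> is the inverse of \<open>cosh : [0, \<infinity>) \<rightarrow> [1, \<infinity>)\<close>.
\<close>

definition scherk_tower :: "real \<Rightarrow> real \<Rightarrow> real" where
  "scherk_tower x y = sqrt 2 * arcosh (scherk_tower_arg x y)"

definition scherk_D :: "nat \<Rightarrow> (real \<times> real) set" where
  "scherk_D m = {(x, y). (sinh (y / (real m * sqrt 2)))\<^sup>2 > 1}"

end

theory Submission
  imports Defs "HOL-Computational_Algebra.Polynomial"
begin

text \<open>
  Where defined, half the sum of the squared hyperbolic cosines equals
  \<open>sinh\<^sup>2 (y / \<surd>2) + sin\<^sup>2 (x / 2) = (cosh (\<surd>2 y) - cos x) / 2\<close>. So the claim is the product formula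
  \<open>\<Prod>j<m. 2 cosh u - 2 cos ((x + 2\<pi>j) / m) = 2 cosh (m u) - 2 cos x\<close>, which is the squared modulus of
  \<open>\<Prod>j<m. z - cis ((x + 2\<pi>j) / m) = z ^ m - cis x\<close> at \<open>z = e\<^sup>u\<close>; the constant comes from
  \<open>\<Prod>0<j<m. 1 - cis (2\<pi>j / m) = m\<close>.
\<close>

text \<open>Both sides are monic of degree \<open>m\<close> and vanish at the \<open>m\<close>
  distinct roots of unity, so their difference has degree below \<open>m\<close> and too many
  zeros.\<close>

lemma prod_roots_unity_poly:
  assumes "m > 0"
  shows "(\<Prod>j<m. [:- cis (2 * pi * real j / real m), 1:]) = monom 1 m - 1"
proof (rule poly_eqI_degree_lead_coeff[where n = m and A = "{z. z ^ m = 1}"])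
  let ?P = "\<Prod>j<m. [:- cis (2 * pi * real j / real m), 1:]"
  have deg: "degree ?P = m"
    by (subst degree_prod_sum_eq) auto
  show "degree ?P \<le> m"
    using deg by simp
  have "lead_coeff ?P = 1"
    by (subst lead_coeff_prod) simp
  then show "coeff ?P m = coeff (monom 1 m - 1) m"
    using deg assms by (simp add: coeff_1)
  show "card {z :: complex. z ^ m = 1} \<ge> m"
    using card_roots_unity_eq[OF assms] by simp
  show "degree (monom 1 m - 1 :: complex poly) \<le> m"
    by (intro degree_diff_le) (auto simp: degree_monom_eq)
  fix z :: complex
  assume "z \<in> {z. z ^ m = 1}"
  moreover from this obtain j where "j < m" "z = cis (2 * pi * real j / real m)"
    using bij_betw_roots_unity[OF assms] unfolding bij_betw_def by blast
  then have "poly ?P z = 0"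
    by (auto simp: poly_prod)
  ultimately show "poly ?P z = poly (monom 1 m - 1) z"
    by (simp add: poly_monom)
qed

text \<open>Pulling an \<open>m\<close>-th root \<open>w\<close> of \<open>cis x\<close> out of
  every factor rotates the points onto the roots of unity; the previous lemma then applies at
  \<open>z / w\<close>.\<close>

lemma prod_diff_cis_shifted:
  assumes "m > 0"
  shows "(\<Prod>j<m. z - cis ((x + 2 * real j * pi) / real m)) = z ^ m - cis x"
proof -
  define w where "w = cis (x / real m)"
  have w: "w \<noteq> 0" "w ^ m = cis x"
    using assms by (simp_all add: w_def DeMoivre)
  have "z - cis ((x + 2 * real j * pi) / real m) = w * (z / w - cis (2 * pi * real j / real m))" for j
    using w(1) by (simp add: w_def algebra_simps cis_mult add_divide_distrib)
  then have "(\<Prod>j<m. z - cis ((x + 2 * real j * pi) / real m)) =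
      w ^ m * poly (\<Prod>j<m. [:- cis (2 * pi * real j / real m), 1:]) (z / w)"
    by (simp add: prod.distrib poly_prod)
  also have "\<dots> = z ^ m - cis x"
    using w(1) by (simp add: prod_roots_unity_poly[OF assms] poly_monom power_divide
        right_diff_distrib flip: w(2))
  finally show ?thesis .
qed

lemma norm_exp_diff_cis_squared:
  "(cmod (of_real (exp u) - cis t))\<^sup>2 = exp u * (2 * cosh u - 2 * cos t)"
proof -
  have "(cmod (of_real (exp u) - cis t))\<^sup>2 = (exp u - cos t)\<^sup>2 + (sin t)\<^sup>2"
    by (simp add: cmod_power2)
  also have "\<dots> = (exp u)\<^sup>2 - 2 * exp u * cos t + 1"
    by (simp add: power2_diff)
  also have "\<dots> = exp u * (2 * cosh u - 2 * cos t)"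
    by (simp add: cosh_field_def exp_minus field_simps power2_eq_square)
  finally show ?thesis .
qed

lemma prod_cosh_minus_cos:
  assumes "m > 0"
  shows "(\<Prod>j<m. 2 * cosh u - 2 * cos ((x + 2 * real j * pi) / real m)) =
    2 * cosh (real m * u) - 2 * cos x"
proof -
  let ?f = "\<lambda>j. 2 * cosh u - 2 * cos ((x + 2 * real j * pi) / real m)"
  \<comment> \<open>One factor \<open>exp u\<close> per term completes it to a squared modulus; the
    closed form carries the same \<open>exp u ^ m\<close>, which cancels at the end.\<close>
  have "exp u ^ m * (\<Prod>j<m. ?f j) =
      (\<Prod>j<m. (cmod (of_real (exp u) - cis ((x + 2 * real j * pi) / real m)))\<^sup>2)"
    by (simp add: norm_exp_diff_cis_squared prod.distrib)
  also have "\<dots> = (cmod (\<Prod>j<m. of_real (exp u) - cis ((x + 2 * real j * pi) / real m)))\<^sup>2"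
    by (simp only: prod_norm flip: prod_power_distrib)
  also have "\<dots> = (cmod (of_real (exp (real m * u)) - cis x))\<^sup>2"
    by (simp only: prod_diff_cis_shifted[OF assms] of_real_power[symmetric] exp_of_nat_mult)
  also have "\<dots> = exp u ^ m * (2 * cosh (real m * u) - 2 * cos x)"
    by (subst norm_exp_diff_cis_squared) (simp only: exp_of_nat_mult)
  finally show ?thesis
    by simp
qed

text \<open>Cancelling the root \<open>1\<close> (the index \<open>0\<close>) from
  \<open>z ^ m - 1\<close> leaves the geometric sum, whose \<open>m\<close> terms all equal 1 at
  \<open>z = 1\<close>.\<close>

lemma prod_one_minus_roots_unity:
  assumes "m > 0"
  shows "(\<Prod>j\<in>{1..<m}. 1 - cis (2 * pi * real j / real m)) = of_nat m"
proof -
  let ?P = "\<Prod>j\<in>{1..<m}. [:- cis (2 * pi * real j / real m), 1:]"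
  have "{..<m} = insert 0 {1..<m}"
    using assms by auto
  then have "[:- 1, 1:] * ?P = (\<Prod>j<m. [:- cis (2 * pi * real j / real m), 1:])"
    by simp
  also have "\<dots> = [:0, 1:] ^ m - 1"
    by (simp add: prod_roots_unity_poly[OF assms] monom_altdef)
  also have "\<dots> = [:- 1, 1:] * (\<Sum>k<m. [:0, 1:] ^ k)"
    using power_diff_1_eq[of "[:0, 1:] :: complex poly" m] by (simp add: one_pCons)
  finally have "?P = (\<Sum>k<m. [:0, 1:] ^ k)"
    by (subst (asm) mult_left_cancel) auto
  then have "poly ?P 1 = poly (\<Sum>k<m. [:0, 1:] ^ k) 1"
    by simp
  then show ?thesis
    by (simp add: poly_prod poly_sum)
qed

lemma prod_sin_squared:
  assumes "m > 0"
  shows "(\<Prod>j\<in>{1..<m}. 4 * (sin (pi * real j / real m))\<^sup>2) = (real m)\<^sup>2"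
proof -
  \<comment> \<open>The case \<open>u = 0\<close> of the modulus formula: the squared chord is
    \<open>2 - 2 * cos t\<close>, that is \<open>4 * (sin (t / 2))\<^sup>2\<close>.\<close>
  have "4 * (sin (pi * real j / real m))\<^sup>2 = (cmod (1 - cis (2 * pi * real j / real m)))\<^sup>2" for j
    using norm_exp_diff_cis_squared[of 0 "2 * pi * real j / real m"]
      cos_double_sin[of "pi * real j / real m"]
    by (simp add: mult.assoc)
  then have "(\<Prod>j\<in>{1..<m}. 4 * (sin (pi * real j / real m))\<^sup>2) =
      (cmod (\<Prod>j\<in>{1..<m}. 1 - cis (2 * pi * real j / real m)))\<^sup>2"
    by (simp only: prod_norm flip: prod_power_distrib)
  then show ?thesis
    by (simp only: prod_one_minus_roots_unity[OF assms] norm_of_nat)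
qed

lemma scherk_tower_dom_iff:
  "(x, y) \<in> scherk_tower_dom \<longleftrightarrow> 1 \<le> (sinh (y / sqrt 2))\<^sup>2 + 2 * (sin (x / 2))\<^sup>2"
  by (simp add: scherk_tower_dom_def scherk_tower_arg_def)

lemma cosh_scherk_tower_squared:
  assumes "(x, y) \<in> scherk_tower_dom"
  shows "(cosh (scherk_tower x y / sqrt 2))\<^sup>2 = (sinh (y / sqrt 2))\<^sup>2 + 2 * (sin (x / 2))\<^sup>2"
  \<comment> \<open>The argument stays folded until \<open>cosh\<close> has cancelled
    \<open>arcosh\<close>, which needs it to be at least 1; only then is the square root
    opened.\<close>
  using assms by (simp add: scherk_tower_dom_def scherk_tower_def) (simp add: scherk_tower_arg_def)

text \<open>The term at 0 has no sine part, so averaging halves the coefficient 2 of the sine; the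
  double-angle formulas do the rest. The right side is shaped to match
  \<open>prod_cosh_minus_cos\<close>.\<close>

lemma cosh_scherk_tower_average:
  assumes "(x, y) \<in> scherk_tower_dom" "(0, y) \<in> scherk_tower_dom"
  shows "1 / 2 * ((cosh (scherk_tower x y / sqrt 2))\<^sup>2 + (cosh (scherk_tower 0 y / sqrt 2))\<^sup>2) =
    1 / 4 * (2 * cosh (2 * (y / sqrt 2)) - 2 * cos x)"
  using cosh_scherk_tower_squared[OF assms(1)] cosh_scherk_tower_squared[OF assms(2)]
    cos_double_sin[of "x / 2"] cosh_double[of "y / sqrt 2"] cosh_square_eq[of "y / sqrt 2"]
  by simp

theorem theorem5p1:
  fixes m :: nat and x y :: real
  assumes "m \<ge> 1" and "(x, y) \<in> scherk_D m"
  shows "(x, y) \<in> scherk_tower_dom \<and>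
    (0, y) \<in> scherk_tower_dom \<and>
    (\<forall>j<m. ((x + 2 * real j * pi) / real m, y / real m) \<in> scherk_tower_dom) \<and>
    (0, y / real m) \<in> scherk_tower_dom \<and>
    1 / 2 * ((cosh (scherk_tower x y / sqrt 2))\<^sup>2 + (cosh (scherk_tower 0 y / sqrt 2))\<^sup>2) =
      (real m)\<^sup>2 * (\<Prod>j\<in>{1..<m}. 1 / (sin (pi * real j / real m))\<^sup>2) *
      (\<Prod>j\<in>{0..<m}. 1 / 2 *
        ((cosh (1 / sqrt 2 * scherk_tower ((x + 2 * real j * pi) / real m) (y / real m)))\<^sup>2 +
         (cosh (1 / sqrt 2 * scherk_tower 0 (y / real m)))\<^sup>2))"
proof -
  from assms(1) have m: "m > 0"
    by simp
  have small: "1 < (sinh (y / real m / sqrt 2))\<^sup>2"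
    using assms(2) by (simp add: scherk_D_def)
  \<comment> \<open>Undoing the dilation only enlarges \<open>\<bar>sinh\<bar>\<close>, so the bound
    at the small scale carries over. As the sine term is nonnegative, the first coordinate is then
    arbitrary.\<close>
  have "\<bar>y / real m / sqrt 2\<bar> \<le> \<bar>y / sqrt 2\<bar>"
    using m mult_left_mono[of 1 "real m" "\<bar>y\<bar>"] by (simp add: abs_divide field_simps)
  then have "\<bar>sinh (y / real m / sqrt 2)\<bar> \<le> \<bar>sinh (y / sqrt 2)\<bar>"
    by (simp only: sinh_real_abs[symmetric] sinh_real_le_iff)
  then have "1 < (sinh (y / sqrt 2))\<^sup>2"
    using small by (simp only: abs_le_square_iff)
  then have dom: "(t, y) \<in> scherk_tower_dom" for t
    by (simp add: scherk_tower_dom_iff add_increasing2)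
  have dom': "(t, y / real m) \<in> scherk_tower_dom" for t
    using small by (simp add: scherk_tower_dom_iff add_increasing2)
  define C where "C = 2 * cosh (2 * (y / sqrt 2)) - 2 * cos x"
  \<comment> \<open>Chosen so that \<open>real m * u\<close> is the undilated argument, which makes
    the product collapse to the same \<open>C\<close> as the left side of the claim.\<close>
  define u where "u = 2 * (y / real m / sqrt 2)"
  have mu: "real m * u = 2 * (y / sqrt 2)"
    using m by (simp add: u_def)
  have factors: "(\<Prod>j\<in>{0..<m}. 1 / 2 *
        ((cosh (1 / sqrt 2 * scherk_tower ((x + 2 * real j * pi) / real m) (y / real m)))\<^sup>2 +
         (cosh (1 / sqrt 2 * scherk_tower 0 (y / real m)))\<^sup>2)) = (1 / 4) ^ m * C"
  proof -
    have "1 / 2 *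
        ((cosh (1 / sqrt 2 * scherk_tower t (y / real m)))\<^sup>2 +
         (cosh (1 / sqrt 2 * scherk_tower 0 (y / real m)))\<^sup>2) = 1 / 4 * (2 * cosh u - 2 * cos t)" for t
      using cosh_scherk_tower_average[OF dom' dom'] by (simp add: u_def)
    then show ?thesis
      by (simp only: prod.distrib prod_constant prod_cosh_minus_cos[OF m] mu C_def
          atLeast0LessThan card_lessThan)
  qed
  define S where "S = (\<Prod>j\<in>{1..<m}. (sin (pi * real j / real m))\<^sup>2)"
  \<comment> \<open>The index 0 is absent, hence the exponent \<open>m - 1\<close>; against the
    \<open>m\<close> factors \<open>1 / 4\<close> of the other product, exactly one
    \<open>1 / 4\<close> survives.\<close>
  have S: "4 ^ (m - 1) * S = (real m)\<^sup>2"
    using prod_sin_squared[OF m] by (simp add: S_def prod.distrib)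
  then have "S \<noteq> 0"
    using m by auto
  have inv: "(\<Prod>j\<in>{1..<m}. 1 / (sin (pi * real j / real m))\<^sup>2) = 1 / S"
    by (simp add: S_def prod_dividef)
  have "(real m)\<^sup>2 * (1 / S) * ((1 / 4) ^ m * C) = 4 ^ (m - 1) * (1 / 4) ^ m * C"
    using \<open>S \<noteq> 0\<close> by (simp flip: S)
  also have "\<dots> = 1 / 4 * C"
    using m by (cases m) (simp_all add: power_divide)
  finally show ?thesis
    unfolding factors inv cosh_scherk_tower_average[OF dom dom] C_def
    using dom dom' by simp
qed

end
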